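(* Let $A\in\mathbb{R}^{m\times n}$ with rows $a_1^T,\dots,a_m^T$, $b=[b_1,\dots,b_m]^T\in\mathbb{R}^m$ and $f:\mathbb{R}^n\to\mathbb{R}$. Assume $f$ is twice differentiable and there are constants $\mu,\ell>0$ with $\mu\|x-y\|^2\le\langle\nabla f(x)-\nabla f(y),x-y\rangle\le\ell\|x-y\|^2$ for all $x,y\in\mathbb{R}^n$. Assume $A$ has full row rank and $\kappa_1 I\preceq AA^T\preceq\kappa_2 I$ for some $\kappa_1,\kappa_2>0$. Let $\eta>0$, $\rho>0$ and consider the dynamics on $\mathbb{R}^n\times\mathbb{R}^m$ $$\dot x=-\nabla f(x)-\sum_{j=1}^m\max(\rho(a_j^Tx-b_j)+\lambda_j,0)\,a_j,$$ $$\dot\lambda=\eta\sum_{j=1}^m\frac{\max(\rho(a_j^Tx-b_j)+\lambda_j,0)-\lambda_j}{\rho}\,e_j,$$ where $e_j\in\mathbb{R}^m$ is the $j$-th standard basis vector. Let $(x^*,\lambda^* )$ be its equilibrium point. Define $$\tau_{ineq}=\frac{\eta\kappa_1^2}{40\,\ell\,\kappa_2\,[\max(\frac{\rho\kappa_2}{\mu},\frac{\ell}{\mu})]^2\,[\max(\frac{\eta}{\ell\rho},\frac{\ell}{\mu})]^2}.$$ Then the dynamics is globally exponentially stable in the sense that for every solution $(x(t),\lambda(t))$, $t\ge0$, there exist constants $C_3,C_4>0$, depending only on $\eta,\rho,\kappa_1,\kappa_2,\mu,\ell,\|x(0)-x^*\|,\|\lambda(0)-\lambda^*\|$, such that for all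 $t\ge 0$ $$\|x(t)-x^*\|\le C_3e^{-\frac12\tau_{ineq}t},\qquad\|\lambda(t)-\lambda^*\|\le C_4e^{-\frac12\tau_{ineq}t}.$$
   Context: $\|\cdot\|$ is the Euclidean norm; $M_1\succeq M_2$ for symmetric matrices means $M_1-M_2$ is positive semidefinite. The dynamics (Aug-PDGD) is the primal-dual gradient dynamics $\dot x=-\nabla_xL$, $\dot\lambda=\eta\nabla_\lambda L$ of the augmented Lagrangian $L(x,\lambda)=f(x)+\sum_{j=1}^mH_\rho(a_j^Tx-b_j,\lambda_j)$ of the problem $\min_xf(x)$ subject to $Ax\le b$, where $H_\rho(u,\lambda_j)=u\lambda_j+\frac{\rho}{2}u^2$ if $\rho u+\lambda_j\ge0$ and $H_\rho(u,\lambda_j)=-\frac12\frac{\lambda_j^2}{\rho}$ if $\rho u+\lambda_j<0$. Under the stated assumptions the equilibrium point $(x^*,\lambda^* )$ exists, is unique, and satisfies the KKT conditions of this problem. *)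

theory Defs
  imports "HOL-Analysis.Analysis"
begin

text \<open>
  The constants of the exponential estimate must not depend on the dimensions \<open>n\<close> and \<open>m\<close>, so
  the dimensions have to be quantified inside an existential quantifier and cannot be encoded as
  type parameters (as in \<open>real ^ 'n\<close>).  We therefore work in one ambient real inner product space,
  the finitely supported real sequences, and represent Euclidean \<open>n\<close>-space by the subspace
  \<open>Rn n\<close> of sequences supported on \<open>{..<n}\<close>; coordinates are numbered from \<open>0\<close>.  On \<open>Rn n\<close>, the
  ambient inner product, norm and topology are the usual Euclidean ones
  (see \<open>inner_Rn\<close> and \<open>norm_Rn\<close>).
\<close>

typedef fseq = "{f :: nat \<Rightarrow> real. finite {i. f i \<noteq> 0}}"
  morphisms coord Abs_fseq
  by (rule exI[of _ "\<lambda>_. 0"]) simp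

setup_lifting type_definition_fseq

lemma finite_coord_support [simp]: "finite {i. coord x i \<noteq> 0}"
  using coord[of x] by simp

lemma fseq_eqI: "(\<And>i. coord x i = coord y i) \<Longrightarrow> x = y"
  by (simp add: coord_inject[symmetric] fun_eq_iff)

instantiation fseq :: real_vector
begin

lift_definition zero_fseq :: fseq is "\<lambda>_. 0"
  by simp

lift_definition plus_fseq :: "fseq \<Rightarrow> fseq \<Rightarrow> fseq" is "\<lambda>f g i. f i + g i"
  subgoal for f g
    by (rule finite_subset[of _ "{i. f i \<noteq> 0} \<union> {i. g i \<noteq> 0}"]) auto
  done

lift_definition minus_fseq :: "fseq \<Rightarrow> fseq \<Rightarrow> fseq" is "\<lambda>f g i. f i - g i"
  subgoal for f g
    by (rule finite_subset[of _ "{i. f i \<noteq> 0} \<union> {i. g i \<noteq> 0}"]) auto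
  done

lift_definition uminus_fseq :: "fseq \<Rightarrow> fseq" is "\<lambda>f i. - f i"
  by simp

lift_definition scaleR_fseq :: "real \<Rightarrow> fseq \<Rightarrow> fseq" is "\<lambda>r f i. r * f i"
  by (erule finite_subset[rotated]) auto

instance
  by standard (transfer, simp add: algebra_simps fun_eq_iff)+

end

lemmas coord_simps [simp] =
  zero_fseq.rep_eq plus_fseq.rep_eq minus_fseq.rep_eq uminus_fseq.rep_eq scaleR_fseq.rep_eq

lemma coord_sum [simp]: "coord (\<Sum>j\<in>S. h j) i = (\<Sum>j\<in>S. coord (h j) i)"
  by (induction S rule: infinite_finite_induct) auto

instantiation fseq :: real_inner
begin

definition inner_fseq :: "fseq \<Rightarrow> fseq \<Rightarrow> real" where
  "inner_fseq x y = (\<Sum>i\<in>{i. coord x i \<noteq> 0}. coord x i * coord y i)"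

definition norm_fseq :: "fseq \<Rightarrow> real" where
  "norm_fseq x = sqrt (inner x x)"

definition sgn_fseq :: "fseq \<Rightarrow> fseq" where
  "sgn_fseq x = x /\<^sub>R norm x"

definition dist_fseq :: "fseq \<Rightarrow> fseq \<Rightarrow> real" where
  "dist_fseq x y = norm (x - y)"

definition uniformity_fseq :: "(fseq \<times> fseq) filter" where
  "uniformity_fseq = (INF e\<in>{0<..}. principal {(x, y). dist x y < e})"

definition open_fseq :: "fseq set \<Rightarrow> bool" where
  "open_fseq U \<longleftrightarrow> (\<forall>x\<in>U. eventually (\<lambda>(x', y). x' = x \<longrightarrow> y \<in> U) uniformity)"

lemma inner_fseq_superset:
  assumes "finite S" "{i. coord x i \<noteq> 0} \<subseteq> S"
  shows "inner x y = (\<Sum>i\<in>S. coord x i * coord y i)"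
  unfolding inner_fseq_def using assms by (intro sum.mono_neutral_left) auto

instance
proof
  fix x y z :: fseq and r :: real
  let ?S = "{i. coord x i \<noteq> 0} \<union> {i. coord y i \<noteq> 0}"
  have S: "finite ?S" by simp
  have x: "inner x w = (\<Sum>i\<in>?S. coord x i * coord w i)" for w
    by (rule inner_fseq_superset) auto
  have y: "inner y w = (\<Sum>i\<in>?S. coord y i * coord w i)" for w
    by (rule inner_fseq_superset) auto
  show "inner x y = inner y x"
    unfolding x y by (simp add: mult.commute)
  have "inner (x + y) z = (\<Sum>i\<in>?S. coord (x + y) i * coord z i)"
    by (rule inner_fseq_superset) auto
  then show "inner (x + y) z = inner x z + inner y z"
    unfolding x y by (simp add: sum.distrib algebra_simps)
  have "inner (r *\<^sub>R x) y = (\<Sum>i\<in>?S. coord (r *\<^sub>R x) i * coord y i)"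
    by (rule inner_fseq_superset) auto
  then show "inner (r *\<^sub>R x) y = r * inner x y"
    unfolding x by (simp add: sum_distrib_left mult.assoc)
  show "0 \<le> inner x x"
    unfolding inner_fseq_def by (intro sum_nonneg) simp
  show "inner x x = 0 \<longleftrightarrow> x = 0"
  proof
    assume "inner x x = 0"
    then have "\<forall>i\<in>{i. coord x i \<noteq> 0}. coord x i * coord x i = 0"
      unfolding inner_fseq_def by (subst (asm) sum_nonneg_eq_0_iff) auto
    then show "x = 0"
      by (intro fseq_eqI) auto
  qed (simp add: inner_fseq_def)
qed (simp_all add: norm_fseq_def sgn_fseq_def dist_fseq_def uniformity_fseq_def open_fseq_def)

end

definition Rn :: "nat \<Rightarrow> fseq set" where
  "Rn n = {x. \<forall>i\<ge>n. coord x i = 0}"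

lift_definition unit_vec :: "nat \<Rightarrow> fseq" is "\<lambda>j i. if i = j then 1 else 0"
  by simp

lemma subspace_Rn: "subspace (Rn n)"
  by (simp add: subspace_def Rn_def)

lemma inner_Rn:
  assumes "x \<in> Rn n"
  shows "inner x y = (\<Sum>i<n. coord x i * coord y i)"
  using assms by (intro inner_fseq_superset) (auto simp: Rn_def not_less[symmetric])

lemma norm_Rn: "x \<in> Rn n \<Longrightarrow> norm x = sqrt (\<Sum>i<n. (coord x i)\<^sup>2)"
  by (simp add: norm_eq_sqrt_inner inner_Rn power2_eq_square)

text \<open>\<open>f\<close> and \<open>g\<close> are only relevant on \<open>Rn n\<close>; for \<open>x \<in> Rn n\<close> the gradient \<open>g x\<close> is uniquely
  determined because it is required to lie in \<open>Rn n\<close>.\<close>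

definition has_gradient_field :: "nat \<Rightarrow> (fseq \<Rightarrow> real) \<Rightarrow> (fseq \<Rightarrow> fseq) \<Rightarrow> bool" where
  "has_gradient_field n f g \<longleftrightarrow>
     (\<forall>x\<in>Rn n. g x \<in> Rn n \<and> (f has_derivative (\<lambda>h. inner (g x) h)) (at x within Rn n))"

text \<open>Matrices of size \<open>m \<times> m\<close> are functions of two indices, relevant for indices below \<open>m\<close>.\<close>

definition pos_semidef :: "nat \<Rightarrow> (nat \<Rightarrow> nat \<Rightarrow> real) \<Rightarrow> bool" where
  "pos_semidef m M \<longleftrightarrow>
     (\<forall>i<m. \<forall>j<m. M i j = M j i) \<and>
     (\<forall>v :: nat \<Rightarrow> real. 0 \<le> (\<Sum>i<m. \<Sum>j<m. v i * M i j * v j))"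

definition loewner_le :: "nat \<Rightarrow> (nat \<Rightarrow> nat \<Rightarrow> real) \<Rightarrow> (nat \<Rightarrow> nat \<Rightarrow> real) \<Rightarrow> bool" where
  "loewner_le m M1 M2 \<longleftrightarrow> pos_semidef m (\<lambda>i j. M2 i j - M1 i j)"

definition scaled_id :: "real \<Rightarrow> nat \<Rightarrow> nat \<Rightarrow> real" where
  "scaled_id c i j = (if i = j then c else 0)"

text \<open>A matrix \<open>A\<close> of size \<open>m \<times> n\<close> is given by its rows \<open>a 0, \<dots>, a (m - 1) \<in> Rn n\<close>.\<close>

definition full_row_rank :: "nat \<Rightarrow> (nat \<Rightarrow> fseq) \<Rightarrow> bool" where
  "full_row_rank m a \<longleftrightarrow> dim (a ` {..<m}) = m"

text \<open>The entries of \<open>A A\<^sup>T\<close>.\<close>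

definition row_gram :: "(nat \<Rightarrow> fseq) \<Rightarrow> nat \<Rightarrow> nat \<Rightarrow> real" where
  "row_gram a i j = inner (a i) (a j)"

definition primal_field ::
  "nat \<Rightarrow> (fseq \<Rightarrow> fseq) \<Rightarrow> (nat \<Rightarrow> fseq) \<Rightarrow> fseq \<Rightarrow> real \<Rightarrow> fseq \<Rightarrow> fseq \<Rightarrow> fseq" where
  "primal_field m g a b \<rho> x l =
     - g x - (\<Sum>j<m. max (\<rho> * (inner (a j) x - coord b j) + coord l j) 0 *\<^sub>R a j)"

definition dual_field ::
  "nat \<Rightarrow> (nat \<Rightarrow> fseq) \<Rightarrow> fseq \<Rightarrow> real \<Rightarrow> real \<Rightarrow> fseq \<Rightarrow> fseq \<Rightarrow> fseq" where
  "dual_field m a b \<rho> \<eta> x l =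
     \<eta> *\<^sub>R (\<Sum>j<m. ((max (\<rho> * (inner (a j) x - coord b j) + coord l j) 0 - coord l j) / \<rho>)
                    *\<^sub>R unit_vec j)"

definition is_equilibrium ::
  "nat \<Rightarrow> nat \<Rightarrow> (fseq \<Rightarrow> fseq) \<Rightarrow> (nat \<Rightarrow> fseq) \<Rightarrow> fseq \<Rightarrow> real \<Rightarrow> real \<Rightarrow> fseq \<Rightarrow> fseq \<Rightarrow> bool"
where
  "is_equilibrium n m g a b \<rho> \<eta> x l \<longleftrightarrow>
     x \<in> Rn n \<and> l \<in> Rn m \<and> primal_field m g a b \<rho> x l = 0 \<and> dual_field m a b \<rho> \<eta> x l = 0"

definition is_solution ::
  "nat \<Rightarrow> nat \<Rightarrow> (fseq \<Rightarrow> fseq) \<Rightarrow> (nat \<Rightarrow> fseq) \<Rightarrow> fseq \<Rightarrow> real \<Rightarrow> real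
    \<Rightarrow> (real \<Rightarrow> fseq) \<Rightarrow> (real \<Rightarrow> fseq) \<Rightarrow> bool"
where
  "is_solution n m g a b \<rho> \<eta> x l \<longleftrightarrow>
     (\<forall>t\<ge>0. x t \<in> Rn n \<and> l t \<in> Rn m \<and>
        (x has_vector_derivative primal_field m g a b \<rho> (x t) (l t)) (at t within {0..}) \<and>
        (l has_vector_derivative dual_field m a b \<rho> \<eta> (x t) (l t)) (at t within {0..}))"

definition tau_ineq :: "real \<Rightarrow> real \<Rightarrow> real \<Rightarrow> real \<Rightarrow> real \<Rightarrow> real \<Rightarrow> real" where
  "tau_ineq \<eta> \<rho> \<kappa>1 \<kappa>2 \<mu> ell =
     \<eta> * \<kappa>1\<^sup>2 / (40 * ell * \<kappa>2 * (max (\<rho> * \<kappa>2 / \<mu>) (ell / \<mu>))\<^sup>2 * (max (\<eta> / (ell * \<rho>)) (ell / \<mu>))\<^sup>2)"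

end

theory Submission
  imports Defs
begin

text \<open>
  Write \<open>x\<close>, \<open>v\<close> for the deviations of the primal and the dual variable from the equilibrium. The
  proof exhibits the quadratic Lyapunov function
  \[V = \eta c \|x\|^2 + 2 \eta \langle A x, v \rangle + c \|v\|^2, \qquad
    c = \frac{20\,\ell\,\kappa_2}{\kappa_1}\, M_1^2 M_2^2,\]
  where \<open>M\<^sub>1\<close> and \<open>M\<^sub>2\<close> are the two maxima in the definition of the rate. With this \<open>c\<close> the rate is
  \<open>\<tau> = \<eta> \<kappa>1 / (2 c)\<close>, and the claim reduces to \<open>V' \<le> - \<tau> V\<close>: then \<open>V\<close> decays like \<open>exp (- \<tau> t)\<close>,
  and since \<open>c\<close> is large enough for the cross term to be absorbed, \<open>V\<close> is comparable to
  \<open>\<eta> \<parallel>x\<parallel>\<^sup>2 + \<parallel>v\<parallel>\<^sup>2\<close> up to the factor \<open>3\<close>, independently of all dimensions.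

  The dynamics is piecewise smooth because of the maxima. This is removed by writing
  \<open>max p 0 - max q 0 = \<gamma> (p - q)\<close> with \<open>\<gamma> \<in> [0, 1]\<close>: along a solution the deviations obey
  \[x' = - d - A^T w, \qquad v' = \frac{\eta}{\rho} (w - v), \qquad w_j = \gamma_j (\rho (A x)_j + v_j),\]
  where \<open>d\<close> is the difference of the gradients. All that is used about \<open>\<gamma>\<close> is that its entries lie in
  \<open>[0, 1]\<close>, so \<open>V' \<le> - \<tau> V\<close> becomes a static inequality, \<open>lyapunov_dissipation\<close>.

  In that inequality the diagonal part of \<open>V\<close> produces decay of \<open>\<langle>d, x\<rangle>\<close>, of the components of \<open>A x\<close>
  weighted with \<open>\<gamma>\<close> and of the components of \<open>v\<close> weighted with \<open>1 - \<gamma>\<close>. Multipliers of active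
  constraints (\<open>\<gamma> = 1\<close>) are not damped by it; they are damped by the cross term, which contributes
  \<open>- \<parallel>A\<^sup>T v\<parallel>\<^sup>2 \<le> - \<kappa>1 \<parallel>v\<parallel>\<^sup>2\<close>. Every remaining term is bounded by products of damped quantities and is
  absorbed by Young's inequality, since \<open>c\<close> dominates \<open>\<ell>\<close>, \<open>\<rho> \<kappa>2\<close>, \<open>\<eta> / \<rho>\<close> and \<open>\<kappa>2 \<eta> / \<mu>\<close>
  (\<open>lyapunov_weight_bounds\<close>). The term \<open>\<langle>A\<^sup>T v, d\<rangle>\<close> needs \<open>\<parallel>d\<parallel>\<^sup>2 \<le> \<ell> \<langle>d, x\<rangle>\<close>, the cocoercivity of the
  gradient (\<open>gradient_cocoercive\<close>), which holds since the gradient is monotone and its increments are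
  bounded by \<open>\<ell>\<close> in the direction of the displacement.
\<close>

section \<open>Cocoercivity of a monotone gradient\<close>

lemma gradient_field_line_derivative:
  assumes f: "has_gradient_field n f g" and y: "y \<in> Rn n" and h: "h \<in> Rn n"
  shows "((\<lambda>s. f (y + s *\<^sub>R h)) has_real_derivative inner (g (y + s *\<^sub>R h)) h) (at s)"
proof -
  have line: "y + r *\<^sub>R h \<in> Rn n" for r
    using y h subspace_Rn by (simp add: subspace_add subspace_scale)
  have "((\<lambda>r. y + r *\<^sub>R h) has_derivative (\<lambda>r. r *\<^sub>R h)) (at s within UNIV)"
    by (auto intro!: derivative_eq_intros)
  moreover have "(f has_derivative (\<lambda>k. inner (g p) k)) (at p within Rn n)" if "p \<in> Rn n" for p
    using f that by (simp add: has_gradient_field_def)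
  moreover have "range (\<lambda>r. y + r *\<^sub>R h) \<subseteq> Rn n"
    using line by blast
  ultimately have "((\<lambda>r. f (y + r *\<^sub>R h)) has_derivative (\<lambda>r. inner (g (y + s *\<^sub>R h)) (r *\<^sub>R h)))
      (at s within UNIV)"
    using has_derivative_in_compose2[of "Rn n" f "\<lambda>p. inner (g p)" "\<lambda>r. y + r *\<^sub>R h" UNIV s "\<lambda>r. r *\<^sub>R h"]
    by simp
  then show ?thesis
    by (simp add: has_field_derivative_def mult_commute_abs)
qed

text \<open>
  Along the segment, \<open>f\<close> minus the quadratic on the right-hand side has nonpositive derivative, which
  is the bound \<open>upper\<close> between the point \<open>y + s *\<^sub>R h\<close> and \<open>y\<close>. Besides the
  descent step it yields convexity, by taking \<open>ell = 0\<close> and \<open>- f\<close> in place of \<open>f\<close>.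
\<close>

lemma gradient_descent_bound:
  assumes f: "has_gradient_field n f g" and y: "y \<in> Rn n" and h: "h \<in> Rn n"
    and upper: "\<And>y z. y \<in> Rn n \<Longrightarrow> z \<in> Rn n \<Longrightarrow> inner (g y - g z) (y - z) \<le> ell * (norm (y - z))\<^sup>2"
  shows "f (y + h) \<le> f y + inner (g y) h + ell / 2 * (norm h)\<^sup>2"
proof -
  define \<psi> where "\<psi> s = f (y + s *\<^sub>R h) - s * inner (g y) h - ell / 2 * s\<^sup>2 * (norm h)\<^sup>2" for s
  have line: "y + r *\<^sub>R h \<in> Rn n" for r
    using y h subspace_Rn by (simp add: subspace_add subspace_scale)
  have deriv: "(\<psi> has_real_derivative
      inner (g (y + s *\<^sub>R h)) h - inner (g y) h - ell * s * (norm h)\<^sup>2) (at s)" for s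
    unfolding \<psi>_def
    by (rule derivative_eq_intros gradient_field_line_derivative[OF f y h] refl | simp)+
  have "\<psi> 1 \<le> \<psi> 0"
  proof (rule DERIV_nonpos_imp_decreasing_open[where f = \<psi>])
    fix s :: real
    assume s: "0 < s" "s < 1"
    have "inner (g (y + s *\<^sub>R h) - g y) (s *\<^sub>R h) \<le> ell * (norm (s *\<^sub>R h))\<^sup>2"
      using upper[OF line[of s] y] by simp
    then have "s * (inner (g (y + s *\<^sub>R h) - g y) h) \<le> s * (ell * s * (norm h)\<^sup>2)"
      using s by (simp add: power_mult_distrib power2_eq_square algebra_simps)
    then have "inner (g (y + s *\<^sub>R h) - g y) h \<le> ell * s * (norm h)\<^sup>2"
      using s by (simp only: mult_le_cancel_left_pos)
    then show "\<exists>D. (\<psi> has_real_derivative D) (at s) \<and> D \<le> 0"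
      using deriv[of s] by (intro exI[of _ "inner (g (y + s *\<^sub>R h)) h - inner (g y) h - ell * s * (norm h)\<^sup>2"])
        (simp add: inner_diff_left)
  qed (auto intro!: DERIV_continuous_on[OF DERIV_subset[OF deriv]])
  then show ?thesis
    by (simp add: \<psi>_def)
qed

lemma gradient_monotone_imp_tangent_below:
  assumes f: "has_gradient_field n f g" and y: "y \<in> Rn n" and z: "z \<in> Rn n"
    and mono: "\<And>y z. y \<in> Rn n \<Longrightarrow> z \<in> Rn n \<Longrightarrow> 0 \<le> inner (g y - g z) (y - z)"
  shows "f z + inner (g z) (y - z) \<le> f y"
proof -
  have neg: "has_gradient_field n (\<lambda>y. - f y) (\<lambda>y. - g y)"
    using f subspace_neg[OF subspace_Rn]
    by (auto simp: has_gradient_field_def intro!: derivative_eq_intros)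
  have "y - z \<in> Rn n"
    using y z subspace_Rn by (simp add: subspace_diff)
  then have "- f (z + (y - z)) \<le> - f z + inner (- g z) (y - z) + 0 / 2 * (norm (y - z))\<^sup>2"
    by (rule gradient_descent_bound[OF neg z])
       (use mono in \<open>force simp: inner_diff_left\<close>)
  then show ?thesis by simp
qed

text \<open>
  The Baillon-Haddad argument. Subtracting the tangent of \<open>f\<close> at \<open>q\<close> gives a convex function that is
  minimal at \<open>q\<close>; one gradient step of length \<open>1 / ell\<close> from \<open>p\<close> lowers it by at least
  \<open>\<parallel>g p - g q\<parallel>\<^sup>2 / (2 ell)\<close>, and it stays above its minimum. Adding the two inequalities with the roles
  of \<open>p\<close> and \<open>q\<close> exchanged eliminates the values of \<open>f\<close>.
\<close>

lemma gradient_cocoercive: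
  assumes f: "has_gradient_field n f g" and ell: "ell > 0" and y: "y \<in> Rn n" and z: "z \<in> Rn n"
    and mono: "\<And>y z. y \<in> Rn n \<Longrightarrow> z \<in> Rn n \<Longrightarrow> 0 \<le> inner (g y - g z) (y - z)"
    and upper: "\<And>y z. y \<in> Rn n \<Longrightarrow> z \<in> Rn n \<Longrightarrow> inner (g y - g z) (y - z) \<le> ell * (norm (y - z))\<^sup>2"
  shows "(norm (g y - g z))\<^sup>2 \<le> ell * inner (g y - g z) (y - z)"
proof -
  have gap: "f q + inner (g q) (p - q) + (norm (g p - g q))\<^sup>2 / (2 * ell) \<le> f p"
    if p: "p \<in> Rn n" and q: "q \<in> Rn n" for p q
  proof -
    define d where "d = g p - g q"
    \<comment> \<open>minimises the quadratic upper model at \<open>p\<close> of \<open>f\<close> minus its tangent at \<open>q\<close>\<close>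
    define h where "h = - (1 / ell) *\<^sub>R d"
    have "d \<in> Rn n"
      using f p q subspace_diff[OF subspace_Rn] by (auto simp: d_def has_gradient_field_def)
    then have h: "h \<in> Rn n"
      unfolding h_def by (rule subspace_scale[OF subspace_Rn])
    have "f q + inner (g q) (p + h - q) \<le> f (p + h)"
      using subspace_add[OF subspace_Rn p h]
      by (rule gradient_monotone_imp_tangent_below[OF f _ q mono])
    also have "\<dots> \<le> f p + inner (g p) h + ell / 2 * (norm h)\<^sup>2"
      by (rule gradient_descent_bound[OF f p h upper])
    finally have "f q + inner (g q) (p - q) \<le> f p + inner d h + ell / 2 * (norm h)\<^sup>2"
      by (simp add: d_def inner_diff_left inner_diff_right inner_add_right)
    moreover have "inner d h + ell / 2 * (norm h)\<^sup>2 = - (norm d)\<^sup>2 / (2 * ell)"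
      using ell
      by (simp add: h_def power2_norm_eq_inner[symmetric] field_simps power2_eq_square
          dot_square_norm)
    ultimately show ?thesis by (simp add: d_def)
  qed
  have "(norm (g y - g z))\<^sup>2 / ell \<le> inner (g y - g z) (y - z)"
    using gap[OF y z] gap[OF z y] norm_minus_commute[of "g z" "g y"] ell
    by (simp add: inner_diff_left inner_diff_right field_simps)
  then show ?thesis
    using ell by (simp add: field_simps)
qed

section \<open>Auxiliary inequalities\<close>

text \<open>
  A secant slope of \<open>max \<cdot> 0\<close> lies in \<open>[0, 1]\<close>. This turns the nonsmooth field into a linear one with
  state-dependent but uniformly bounded coefficients.
\<close>

lemma max_zero_diff_factor:
  fixes p q :: real
  obtains \<gamma> where "0 \<le> \<gamma>" "\<gamma> \<le> 1" "max p 0 - max q 0 = \<gamma> * (p - q)"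
proof (cases "p = q")
  case True
  then show thesis using that[of 0] by simp
next
  case False
  then show thesis
    by (intro that[of "(max p 0 - max q 0) / (p - q)"]) (auto simp: max_def field_simps)
qed

lemma norm_sum_scaleR_square:
  fixes a :: "'i \<Rightarrow> 'a::real_inner"
  shows "(norm (\<Sum>j\<in>J. w j *\<^sub>R a j))\<^sup>2 = (\<Sum>i\<in>J. \<Sum>j\<in>J. w i * inner (a i) (a j) * w j)"
  unfolding power2_norm_eq_inner inner_sum_left inner_sum_right
  by (simp add: mult_ac inner_commute)

lemma quadratic_form_scaled_id:
  "(\<Sum>i<m. \<Sum>j<m. w i * scaled_id c i j * w j) = c * (\<Sum>j<m. (w j)\<^sup>2)"
proof -
  have "w i * scaled_id c i j * w j = (if i = j then c * (w i)\<^sup>2 else 0)" for i j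
    by (simp add: scaled_id_def power2_eq_square)
  then show ?thesis by (simp add: sum_distrib_left)
qed

lemma gram_lower_bound:
  assumes "loewner_le m (scaled_id \<kappa>) (row_gram a)"
  shows "\<kappa> * (\<Sum>j<m. (w j)\<^sup>2) \<le> (norm (\<Sum>j<m. w j *\<^sub>R a j))\<^sup>2"
proof -
  have "0 \<le> (\<Sum>i<m. \<Sum>j<m. w i * (row_gram a i j - scaled_id \<kappa> i j) * w j)"
    using assms by (simp add: loewner_le_def pos_semidef_def)
  also have "\<dots> = (norm (\<Sum>j<m. w j *\<^sub>R a j))\<^sup>2 - \<kappa> * (\<Sum>j<m. (w j)\<^sup>2)"
    unfolding quadratic_form_scaled_id[symmetric] norm_sum_scaleR_square row_gram_def
    by (simp add: algebra_simps sum_subtractf)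
  finally show ?thesis by simp
qed

lemma gram_upper_bound:
  assumes "loewner_le m (row_gram a) (scaled_id \<kappa>)"
  shows "(norm (\<Sum>j<m. w j *\<^sub>R a j))\<^sup>2 \<le> \<kappa> * (\<Sum>j<m. (w j)\<^sup>2)"
proof -
  have "0 \<le> (\<Sum>i<m. \<Sum>j<m. w i * (scaled_id \<kappa> i j - row_gram a i j) * w j)"
    using assms by (simp add: loewner_le_def pos_semidef_def)
  also have "\<dots> = \<kappa> * (\<Sum>j<m. (w j)\<^sup>2) - (norm (\<Sum>j<m. w j *\<^sub>R a j))\<^sup>2"
    unfolding quadratic_form_scaled_id[symmetric] norm_sum_scaleR_square row_gram_def
    by (simp add: algebra_simps sum_subtractf)
  finally show ?thesis by simp
qed

text \<open>
  A matrix and its transpose have the same operator norm. With \<open>y = A\<^sup>T A x\<close> the left-hand side is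
  \<open>\<langle>y, x\<rangle>\<close>, and expanding \<open>\<parallel>\<kappa> x - y\<parallel>\<^sup>2 \<ge> 0\<close> avoids square roots.
\<close>

lemma sum_inner_square_bound:
  fixes a :: "'i \<Rightarrow> 'a::real_inner"
  assumes upper: "\<And>w. (norm (\<Sum>j\<in>J. w j *\<^sub>R a j))\<^sup>2 \<le> \<kappa> * (\<Sum>j\<in>J. (w j)\<^sup>2)"
    and "0 < \<kappa>"
  shows "(\<Sum>j\<in>J. (inner (a j) x)\<^sup>2) \<le> \<kappa> * (norm x)\<^sup>2"
proof -
  define S where "S = (\<Sum>j\<in>J. (inner (a j) x)\<^sup>2)"
  define y where "y = (\<Sum>j\<in>J. inner (a j) x *\<^sub>R a j)"
  have "S = inner y x"
    by (simp add: S_def y_def inner_sum_left power2_eq_square)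
  moreover have "(norm y)\<^sup>2 \<le> \<kappa> * S"
    using upper[of "\<lambda>j. inner (a j) x"] by (simp add: S_def y_def)
  moreover have "0 \<le> (norm (\<kappa> *\<^sub>R x - y))\<^sup>2" by simp
  then have "2 * \<kappa> * inner y x \<le> \<kappa>\<^sup>2 * (norm x)\<^sup>2 + (norm y)\<^sup>2"
    unfolding power2_norm_eq_inner
    by (simp add: inner_diff_left inner_diff_right inner_commute[of x y]
        power2_eq_square algebra_simps)
  ultimately have "\<kappa> * S \<le> \<kappa> * (\<kappa> * (norm x)\<^sup>2)"
    by (simp add: power2_eq_square algebra_simps)
  then show ?thesis
    using \<open>0 < \<kappa>\<close> by (simp add: S_def)
qed

text \<open>
  Young's inequality with the weight \<open>1 / 8\<close>: in the dissipation estimate four products with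
  \<open>A\<^sup>T v\<close> are charged to \<open>\<parallel>A\<^sup>T v\<parallel>\<^sup>2\<close>, so one half of that square survives.
\<close>

lemma inner_ge_neg_weighted_squares:
  fixes y z :: "'a::real_inner"
  shows "- ((norm y)\<^sup>2 / 8 + 2 * (norm z)\<^sup>2) \<le> inner y z"
proof -
  have "0 \<le> (norm (y + 4 *\<^sub>R z))\<^sup>2" by simp
  then show ?thesis
    by (simp add: power2_norm_eq_inner inner_add_left inner_add_right inner_commute[of z y])
qed

lemma exponential_decay:
  fixes V V' :: "real \<Rightarrow> real"
  assumes V: "\<And>t. 0 \<le> t \<Longrightarrow> (V has_real_derivative V' t) (at t within {0..})"
    and V': "\<And>t. 0 \<le> t \<Longrightarrow> V' t \<le> - \<tau> * V t"
    and t: "0 \<le> t"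
  shows "V t \<le> V 0 * exp (- \<tau> * t)"
proof -
  have deriv: "((\<lambda>s. V s * exp (\<tau> * s)) has_real_derivative (V' s + \<tau> * V s) * exp (\<tau> * s))
      (at s within {0..})" if "0 \<le> s" for s
    by (rule derivative_eq_intros V[OF that] refl | simp add: algebra_simps)+
  have "V t * exp (\<tau> * t) \<le> V 0 * exp (\<tau> * 0)"
  proof (rule DERIV_nonpos_imp_decreasing_open[OF t, where f = "\<lambda>s. V s * exp (\<tau> * s)"])
    fix s assume s: "0 < s" "s < t"
    then have "((\<lambda>s. V s * exp (\<tau> * s)) has_real_derivative (V' s + \<tau> * V s) * exp (\<tau> * s)) (at s)"
      using deriv[of s] at_within_interior[of s "{0..}"] by (simp add: interior_real_atLeast)
    moreover have "(V' s + \<tau> * V s) * exp (\<tau> * s) \<le> 0"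
      using V'[of s] s by (simp add: mult_nonpos_nonneg)
    ultimately show "\<exists>D. ((\<lambda>s. V s * exp (\<tau> * s)) has_real_derivative D) (at s) \<and> D \<le> 0"
      by blast
  qed (auto intro!: DERIV_continuous_on[OF DERIV_subset[OF deriv]])
  then show ?thesis
    by (simp add: exp_minus field_simps)
qed


section \<open>The Lyapunov function\<close>

text \<open>
  The dissipation inequality \<open>V' \<le> - \<tau> V\<close> at a fixed time, for arbitrary secant slopes \<open>\<gamma>\<close>. The
  diagonal part of \<open>V\<close> contributes \<open>- c\<close> times \<open>\<langle>d, x\<rangle> + \<rho> U + E / \<rho>\<close>, where \<open>U\<close> and \<open>E\<close> are the
  squares of \<open>A x\<close> and \<open>v\<close> weighted with \<open>\<gamma>\<close> and \<open>1 - \<gamma>\<close>; the mixed products of \<open>A x\<close> and \<open>v\<close>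
  cancel because \<open>V\<close> weights \<open>\<parallel>x\<parallel>\<^sup>2\<close> with \<open>\<eta>\<close> relative to \<open>\<parallel>v\<parallel>\<^sup>2\<close>. The cross term of \<open>V\<close>
  contributes \<open>- \<parallel>y\<parallel>\<^sup>2\<close> with \<open>y = A\<^sup>T v\<close>, which is where \<open>\<kappa>1\<close> enters, and products that the bounds on
  \<open>c\<close> allow to be absorbed. All these contributions carry the common factor \<open>2 \<eta>\<close>.
\<close>

lemma lyapunov_dissipation:
  fixes a :: "'i \<Rightarrow> 'a::real_inner" and v \<gamma> w :: "'i \<Rightarrow> real"
  assumes gram_le: "\<And>w. (norm (\<Sum>j\<in>J. w j *\<^sub>R a j))\<^sup>2 \<le> \<kappa>2 * (\<Sum>j\<in>J. (w j)\<^sup>2)"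
    and gram_ge: "\<And>w. \<kappa>1 * (\<Sum>j\<in>J. (w j)\<^sup>2) \<le> (norm (\<Sum>j\<in>J. w j *\<^sub>R a j))\<^sup>2"
    and \<gamma>: "\<And>j. 0 \<le> \<gamma> j" "\<And>j. \<gamma> j \<le> 1"
    and w: "\<And>j. w j = \<gamma> j * (\<rho> * inner (a j) x + v j)"
    and x': "x' = - d - (\<Sum>j\<in>J. w j *\<^sub>R a j)"
    and strong: "\<mu> * (norm x)\<^sup>2 \<le> inner d x"
    and cocoercive: "(norm d)\<^sup>2 \<le> ell * inner d x"
    and pos: "0 < \<mu>" "\<mu> \<le> ell" "0 < \<kappa>1" "\<kappa>1 \<le> \<kappa>2" "0 < \<eta>" "0 < \<rho>" "0 < c"
    and c: "20 * ell \<le> c" "20 * \<rho> * \<kappa>2 \<le> c" "20 * \<eta> \<le> c * \<rho>" "20 * \<kappa>2 * \<eta> \<le> c * \<mu>"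
  shows "2 * \<eta> * c * inner x x'
      + 2 * \<eta> * (\<Sum>j\<in>J. inner (a j) x' * v j + inner (a j) x * (\<eta> / \<rho> * (w j - v j)))
      + 2 * c * (\<Sum>j\<in>J. v j * (\<eta> / \<rho> * (w j - v j)))
    \<le> - (\<eta> * \<kappa>1 / (2 * c)) *
      (\<eta> * c * (norm x)\<^sup>2 + 2 * \<eta> * (\<Sum>j\<in>J. inner (a j) x * v j) + c * (\<Sum>j\<in>J. (v j)\<^sup>2))"
proof -
  define u where "u j = inner (a j) x" for j
  define y where "y = (\<Sum>j\<in>J. v j *\<^sub>R a j)"
  define z1 where "z1 = (\<Sum>j\<in>J. ((1 - \<gamma> j) * v j) *\<^sub>R a j)"
  define z2 where "z2 = (\<Sum>j\<in>J. (\<gamma> j * u j) *\<^sub>R a j)"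
  define X where "X = (norm x)\<^sup>2"
  define Y where "Y = (norm y)\<^sup>2"
  define p where "p = inner d x"
  define E where "E = (\<Sum>j\<in>J. (1 - \<gamma> j) * (v j)\<^sup>2)"
  define U where "U = (\<Sum>j\<in>J. \<gamma> j * (u j)\<^sup>2)"
  define N where "N = (\<Sum>j\<in>J. (v j)\<^sup>2)"
  define \<beta> where "\<beta> = \<kappa>1 * \<eta> / (2 * c)"
  have \<gamma>': "0 \<le> 1 - \<gamma> j" "1 - \<gamma> j \<le> 1" for j
    using \<gamma>[of j] by auto
  have nonneg: "0 \<le> X" "0 \<le> Y" "0 \<le> E" "0 \<le> U" "0 \<le> N"
    unfolding X_def Y_def E_def U_def N_def using \<gamma> \<gamma>' by (auto intro!: sum_nonneg)
  have p: "\<mu> * X \<le> p" "0 \<le> p"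
    using strong pos nonneg(1) unfolding p_def X_def
    by (simp, meson mult_nonneg_nonneg less_imp_le order_trans zero_le_power2)

  \<comment> \<open>\<open>A\<^sup>T w = \<rho> z2 + (y - z1)\<close>: the full \<open>y\<close> is split off because only \<open>\<parallel>y\<parallel>\<^sup>2\<close>, not \<open>\<langle>y, y - z1\<rangle>\<close>, has a
     lower bound in terms of \<open>v\<close>\<close>
  have x'_split: "x' = - d - \<rho> *\<^sub>R z2 - y + z1"
    unfolding x' y_def z1_def z2_def
    by (simp add: w u_def algebra_simps scaleR_sum_right sum.distrib sum_subtractf)
  have yx': "(\<Sum>j\<in>J. inner (a j) x' * v j) = - inner y d - \<rho> * inner y z2 - Y + inner y z1"
  proof -
    have "(\<Sum>j\<in>J. inner (a j) x' * v j) = inner y x'"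
      by (simp add: y_def inner_sum_left mult.commute)
    then show ?thesis
      by (simp add: x'_split inner_diff_right inner_add_right Y_def power2_norm_eq_inner)
  qed
  have yx: "(\<Sum>j\<in>J. u j * v j) = inner y x"
    by (simp add: y_def u_def inner_sum_left mult.commute)
  have xx': "inner x x' = - p - (\<Sum>j\<in>J. w j * u j)"
    by (simp add: x' p_def u_def inner_diff_right inner_sum_right inner_commute[of x])

  have complementary: "- (\<Sum>j\<in>J. w j * u j) + (\<Sum>j\<in>J. v j * (w j - v j)) / \<rho> = - (\<rho> * U) - E / \<rho>"
  proof -
    have "- (w j * u j) + v j * (w j - v j) / \<rho> =
        - (\<rho> * (\<gamma> j * (u j)\<^sup>2)) - (1 - \<gamma> j) * (v j)\<^sup>2 / \<rho>" for j
      using pos by (simp add: w u_def[symmetric] field_simps power2_eq_square)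
    then have "(\<Sum>j\<in>J. - (w j * u j) + v j * (w j - v j) / \<rho>) =
        (\<Sum>j\<in>J. - (\<rho> * (\<gamma> j * (u j)\<^sup>2)) - (1 - \<gamma> j) * (v j)\<^sup>2 / \<rho>)"
      by simp
    then show ?thesis
      by (simp add: U_def E_def sum.distrib sum_subtractf sum_negf sum_distrib_left
          sum_divide_distrib)
  qed

  have u_le: "(\<Sum>j\<in>J. (u j)\<^sup>2) \<le> \<kappa>2 * X"
    unfolding u_def X_def using pos by (intro sum_inner_square_bound gram_le) auto
  have z1_le: "(norm z1)\<^sup>2 \<le> \<kappa>2 * E"
  proof -
    have "((1 - \<gamma> j) * v j)\<^sup>2 \<le> (1 - \<gamma> j) * (v j)\<^sup>2" for j
      using mult_right_mono[OF mult_left_le[OF \<gamma>'(2)[of j] \<gamma>'(1)[of j]], of "(v j)\<^sup>2"]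
      by (simp add: power_mult_distrib power2_eq_square[of "1 - \<gamma> j"])
    then have "\<kappa>2 * (\<Sum>j\<in>J. ((1 - \<gamma> j) * v j)\<^sup>2) \<le> \<kappa>2 * E"
      unfolding E_def using pos by (intro mult_left_mono sum_mono) auto
    with gram_le show ?thesis
      unfolding z1_def by (rule order_trans)
  qed
  have z2_le: "(norm z2)\<^sup>2 \<le> \<kappa>2 * U"
  proof -
    have "(\<gamma> j * u j)\<^sup>2 \<le> \<gamma> j * (u j)\<^sup>2" for j
      using mult_right_mono[OF mult_left_le[OF \<gamma>(2)[of j] \<gamma>(1)[of j]], of "(u j)\<^sup>2"]
      by (simp add: power_mult_distrib power2_eq_square[of "\<gamma> j"])
    then have "\<kappa>2 * (\<Sum>j\<in>J. (\<gamma> j * u j)\<^sup>2) \<le> \<kappa>2 * U"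
      unfolding U_def using pos by (intro mult_left_mono sum_mono) auto
    with gram_le show ?thesis
      unfolding z2_def by (rule order_trans)
  qed

  \<comment> \<open>the part of the cross term coming from the dual velocity; completing the square puts half of the
     available \<open>c E / \<rho>\<close> against \<open>v\<close>, the other half stays for \<open>yz1\<close>\<close>
  have uw: "\<eta> / \<rho> * (\<Sum>j\<in>J. u j * (w j - v j)) \<le>
      \<eta> * U + c / (2 * \<rho>) * E + \<eta>\<^sup>2 / (2 * c * \<rho>) * (\<kappa>2 * X)"
  proof -
    have "\<eta> / \<rho> * (u j * (w j - v j)) \<le>
        \<eta> * (\<gamma> j * (u j)\<^sup>2) + c / (2 * \<rho>) * ((1 - \<gamma> j) * (v j)\<^sup>2) + \<eta>\<^sup>2 / (2 * c * \<rho>) * (u j)\<^sup>2"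
      for j
    proof -
      have "0 \<le> (1 - \<gamma> j) * (c * v j + \<eta> * u j)\<^sup>2 + \<gamma> j * (\<eta> * u j)\<^sup>2"
        using \<gamma>[of j] by simp
      also have "\<dots> = 2 * c * \<rho> * (\<eta> * (\<gamma> j * (u j)\<^sup>2) + c / (2 * \<rho>) * ((1 - \<gamma> j) * (v j)\<^sup>2)
          + \<eta>\<^sup>2 / (2 * c * \<rho>) * (u j)\<^sup>2 - \<eta> / \<rho> * (u j * (w j - v j)))"
        using pos by (simp add: w u_def[symmetric] field_simps power2_eq_square)
      finally show ?thesis
        using pos by (auto simp: zero_le_mult_iff mult_le_0_iff)
    qed
    then have "(\<Sum>j\<in>J. \<eta> / \<rho> * (u j * (w j - v j))) \<le>
        (\<Sum>j\<in>J. \<eta> * (\<gamma> j * (u j)\<^sup>2) + c / (2 * \<rho>) * ((1 - \<gamma> j) * (v j)\<^sup>2) + \<eta>\<^sup>2 / (2 * c * \<rho>) * (u j)\<^sup>2)"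
      by (rule sum_mono)
    also have "\<dots> = \<eta> * U + c / (2 * \<rho>) * E + \<eta>\<^sup>2 / (2 * c * \<rho>) * (\<Sum>j\<in>J. (u j)\<^sup>2)"
      by (simp only: sum.distrib sum_distrib_left U_def E_def)
    also have "\<dots> \<le> \<eta> * U + c / (2 * \<rho>) * E + \<eta>\<^sup>2 / (2 * c * \<rho>) * (\<kappa>2 * X)"
      using u_le pos by (intro add_left_mono mult_left_mono) auto
    finally show ?thesis
      by (simp add: sum_distrib_left)
  qed

  have yd: "- inner y d \<le> Y / 8 + 2 * (ell * p)"
    using inner_ge_neg_weighted_squares[of y d] cocoercive by (simp add: Y_def p_def)
  have yz2: "- (\<rho> * inner y z2) \<le> Y / 8 + 2 * (\<rho>\<^sup>2 * (\<kappa>2 * U))"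
    using inner_ge_neg_weighted_squares[of y "\<rho> *\<^sub>R z2"] mult_left_mono[OF z2_le, of "\<rho>\<^sup>2"]
    by (simp add: Y_def power_mult_distrib)
  have yz1: "inner y z1 \<le> Y / 8 + 2 * (\<kappa>2 * E)"
    using inner_ge_neg_weighted_squares[of y "- z1"] z1_le by (simp add: Y_def)
  have y\<beta>x: "\<beta> * inner y x \<le> Y / 8 + 2 * (\<beta>\<^sup>2 * X)"
    using inner_ge_neg_weighted_squares[of y "- \<beta> *\<^sub>R x"]
    by (simp add: Y_def X_def power_mult_distrib)

  have \<kappa>2: "0 < \<kappa>2" and ell: "0 < ell" using pos by auto
  \<comment> \<open>every error term is a small fraction of one of the decay terms \<open>c p\<close>, \<open>c \<rho> U\<close>, \<open>c E / \<rho>\<close>, and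
     strong monotonicity turns \<open>c \<mu> X\<close> into \<open>c p\<close>\<close>
  have cX: "c * (\<mu> * X) \<le> c * p"
    using p pos by simp
  have bound_p: "ell * p \<le> c * p / 20"
    using mult_right_mono[OF c(1) p(2)] by simp
  have bound_U: "\<rho>\<^sup>2 * (\<kappa>2 * U) \<le> c * \<rho> * U / 20"
    using mult_right_mono[OF c(2), of "\<rho> * U"] nonneg pos
    by (simp add: power2_eq_square mult_ac)
  have bound_E: "\<kappa>2 * E \<le> c * E / \<rho> / 20"
    using mult_right_mono[OF c(2), of "E / \<rho>"] nonneg pos by (simp add: mult_ac)
  have bound_\<eta>U: "\<eta> * U \<le> c * \<rho> * U / 20"
    using mult_right_mono[OF c(3) nonneg(4)] by simp
  have bound_\<kappa>1X: "\<kappa>1 * \<eta> * X \<le> c * (\<mu> * X) / 20"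
  proof -
    have "\<kappa>1 * (\<eta> * X) \<le> \<kappa>2 * (\<eta> * X)"
      using pos nonneg by (intro mult_right_mono) auto
    then show ?thesis
      using mult_right_mono[OF c(4) nonneg(1)] by (simp add: mult_ac)
  qed
  have bound_\<kappa>2X: "\<eta>\<^sup>2 / (2 * c * \<rho>) * (\<kappa>2 * X) \<le> c * (\<mu> * X) / 800"
  proof -
    have "(20 * \<kappa>2 * \<eta>) * (20 * \<eta>) \<le> (c * \<mu>) * (c * \<rho>)"
      using pos \<kappa>2 by (intro mult_mono[OF c(4) c(3)]) auto
    from mult_right_mono[OF this nonneg(1)] show ?thesis
      using pos by (simp add: field_simps power2_eq_square)
  qed
  have bound_\<beta>X: "\<beta>\<^sup>2 * X \<le> c * (\<mu> * X) / 800"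
  proof -
    have "20 * \<kappa>1 * \<eta> \<le> c * \<mu>"
      using c(4) mult_right_mono[OF pos(4) less_imp_le[OF pos(5)]] by linarith
    then have "\<beta> \<le> \<mu> / 40"
      using pos by (simp add: \<beta>_def field_simps)
    moreover have "0 \<le> \<beta>" using pos by (simp add: \<beta>_def)
    ultimately have "\<beta> * \<beta> \<le> (\<mu> / 40) * (\<mu> / 40)"
      by (intro mult_mono) auto
    also have "\<dots> \<le> (\<mu> / 40) * (c / 20)"
      using pos c(1) by (intro mult_left_mono) auto
    finally show ?thesis
      using mult_right_mono[of "\<beta> * \<beta>" "\<mu> / 40 * (c / 20)" X] nonneg
      by (simp add: power2_eq_square mult_ac)
  qed
  have bound_N: "\<kappa>1 * N \<le> Y"
    using gram_ge by (simp add: N_def Y_def y_def)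

  \<comment> \<open>half of the derivative of \<open>V\<close>, divided by \<open>\<eta>\<close>; the last line of the chain is \<open>- \<tau> V\<close> on the
     same scale\<close>
  have "c * inner x x' + (\<Sum>j\<in>J. inner (a j) x' * v j)
        + \<eta> / \<rho> * (\<Sum>j\<in>J. u j * (w j - v j)) + c / \<rho> * (\<Sum>j\<in>J. v j * (w j - v j))
      = - (c * p) - c * \<rho> * U - c * E / \<rho> + (- inner y d - \<rho> * inner y z2 - Y + inner y z1)
        + \<eta> / \<rho> * (\<Sum>j\<in>J. u j * (w j - v j))"
    unfolding xx' yx' using arg_cong[OF complementary, of "\<lambda>r. c * r"]
    by (simp add: algebra_simps)
  also have "\<dots> \<le> - (\<beta> * inner y x) - \<kappa>1 * \<eta> * X / 4 - \<kappa>1 * N / 4"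
  proof -
    have "0 \<le> c * p" "0 \<le> c * \<rho> * U" "0 \<le> c * E / \<rho>" "0 \<le> c * (\<mu> * X)"
      using pos p nonneg by auto
    moreover have "\<eta> / \<rho> * (\<Sum>j\<in>J. u j * (w j - v j)) \<le> \<eta> * U + c * E / \<rho> / 2 + c * (\<mu> * X) / 800"
      using order_trans[OF uw add_left_mono[OF bound_\<kappa>2X]] by (simp add: mult_ac)
    ultimately show ?thesis
      using yd yz2 yz1 y\<beta>x cX bound_p bound_U bound_E bound_\<eta>U bound_\<kappa>1X bound_\<beta>X bound_N nonneg(2)
      by argo
  qed
  finally have "2 * \<eta> * (c * inner x x' + (\<Sum>j\<in>J. inner (a j) x' * v j)
        + \<eta> / \<rho> * (\<Sum>j\<in>J. u j * (w j - v j)) + c / \<rho> * (\<Sum>j\<in>J. v j * (w j - v j)))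
      \<le> 2 * \<eta> * (- (\<beta> * inner y x) - \<kappa>1 * \<eta> * X / 4 - \<kappa>1 * N / 4)"
    using pos by (intro mult_left_mono) auto
  moreover have "2 * \<eta> * (- (\<beta> * inner y x) - \<kappa>1 * \<eta> * X / 4 - \<kappa>1 * N / 4)
      = - (\<eta> * \<kappa>1 / (2 * c)) * (\<eta> * c * X + 2 * \<eta> * inner y x + c * N)"
    using pos by (simp add: \<beta>_def field_simps)
  moreover have "(\<Sum>j\<in>J. inner (a j) x' * v j + inner (a j) x * (\<eta> / \<rho> * (w j - v j)))
      = (\<Sum>j\<in>J. inner (a j) x' * v j) + \<eta> / \<rho> * (\<Sum>j\<in>J. u j * (w j - v j))"
    by (simp add: u_def sum.distrib sum_distrib_left mult_ac)
  moreover have "(\<Sum>j\<in>J. v j * (\<eta> / \<rho> * (w j - v j))) = \<eta> / \<rho> * (\<Sum>j\<in>J. v j * (w j - v j))"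
    by (simp add: sum_distrib_left mult_ac)
  ultimately show ?thesis
    using yx by (simp add: u_def X_def N_def algebra_simps)
qed

text \<open>
  The role of the two maxima: both are at least \<open>1\<close>, so \<open>c \<ge> 20 ell M1 M2\<close>, and each bound results from
  estimating either factor below by \<open>1\<close> or by its first argument.
\<close>

lemma lyapunov_weight_bounds:
  fixes \<mu> ell \<kappa>1 \<kappa>2 \<eta> \<rho> c :: real
  assumes pos: "0 < \<mu>" "\<mu> \<le> ell" "0 < \<kappa>1" "\<kappa>1 \<le> \<kappa>2" "0 < \<eta>" "0 < \<rho>"
    and c: "c = 20 * ell * (max (\<rho> * \<kappa>2 / \<mu>) (ell / \<mu>))\<^sup>2 * (max (\<eta> / (ell * \<rho>)) (ell / \<mu>))\<^sup>2 * \<kappa>2 / \<kappa>1"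
  shows "20 * ell \<le> c" "20 * \<rho> * \<kappa>2 \<le> c" "20 * \<eta> \<le> c * \<rho>" "20 * \<kappa>2 * \<eta> \<le> c * \<mu>"
    and "tau_ineq \<eta> \<rho> \<kappa>1 \<kappa>2 \<mu> ell = \<eta> * \<kappa>1 / (2 * c)"
proof -
  define M1 where "M1 = max (\<rho> * \<kappa>2 / \<mu>) (ell / \<mu>)"
  define M2 where "M2 = max (\<eta> / (ell * \<rho>)) (ell / \<mu>)"
  have ell: "0 < ell" and \<kappa>2: "0 < \<kappa>2" and r: "1 \<le> ell / \<mu>"
    using pos by auto
  have M1: "1 \<le> M1" "\<rho> * \<kappa>2 / \<mu> \<le> M1" and M2: "1 \<le> M2" "\<eta> / (ell * \<rho>) \<le> M2"
    using r by (auto simp: M1_def M2_def le_max_iff_disj)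
  have "M1 * 1 * (M2 * 1) * 1 \<le> M1 * M1 * (M2 * M2) * (\<kappa>2 / \<kappa>1)"
    using M1 M2 pos by (intro mult_mono mult_nonneg_nonneg) auto
  from mult_left_mono[OF this, of "20 * ell"] have M1M2: "20 * ell * (M1 * M2) \<le> c"
    using ell unfolding c M1_def[symmetric] M2_def[symmetric]
    by (simp add: power2_eq_square mult_ac)
  have le: "20 * ell * (s * t) \<le> c" if "s \<le> M1" "t \<le> M2" "0 \<le> s" "0 \<le> t" for s t
  proof -
    have "s * t \<le> M1 * M2"
      using that M1 by (intro mult_mono) auto
    then have "20 * ell * (s * t) \<le> 20 * ell * (M1 * M2)"
      using ell by (intro mult_left_mono) auto
    with M1M2 show ?thesis
      by simp
  qed
  show "20 * ell \<le> c"
    using le[of 1 1] M1 M2 by simp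
  have "\<rho> * \<kappa>2 \<le> ell * (\<rho> * \<kappa>2 / \<mu>)"
    using mult_right_mono[OF r, of "\<rho> * \<kappa>2"] pos by (simp add: mult_ac)
  then show "20 * \<rho> * \<kappa>2 \<le> c"
    using le[of "\<rho> * \<kappa>2 / \<mu>" 1] M1 M2 pos by simp
  show "20 * \<eta> \<le> c * \<rho>"
    using le[of 1 "\<eta> / (ell * \<rho>)"] M1 M2 pos ell by (simp add: field_simps)
  show "20 * \<kappa>2 * \<eta> \<le> c * \<mu>"
    using le[of "\<rho> * \<kappa>2 / \<mu>" "\<eta> / (ell * \<rho>)"] M1 M2 pos ell by (simp add: field_simps)
  show "tau_ineq \<eta> \<rho> \<kappa>1 \<kappa>2 \<mu> ell = \<eta> * \<kappa>1 / (2 * c)"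
    using pos ell \<kappa>2 unfolding tau_ineq_def c M1_def[symmetric] M2_def[symmetric]
    by (simp add: field_simps power2_eq_square)
qed

text \<open>
  The condition on \<open>c\<close> says that \<open>2 sqrt (\<eta> \<kappa>) \<le> c\<close>, so that the cross term of \<open>V\<close> is at most
  half of its diagonal part. Applied with \<open>X\<close>, \<open>N\<close> the norms of the deviations and \<open>S = \<langle>A x, v\<rangle>\<close>.
\<close>

lemma cross_term_absorbed:
  fixes X N S :: real
  assumes S: "\<bar>S\<bar> \<le> sqrt \<kappa> * (X * N)" and pos: "0 < \<eta>" "0 < \<kappa>" "0 < c"
    and c: "4 * \<eta> * \<kappa> \<le> c\<^sup>2"
  shows "c / 2 * (\<eta> * X\<^sup>2 + N\<^sup>2) \<le> \<eta> * c * X\<^sup>2 + 2 * \<eta> * S + c * N\<^sup>2"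
    and "\<eta> * c * X\<^sup>2 + 2 * \<eta> * S + c * N\<^sup>2 \<le> 3 * c / 2 * (\<eta> * X\<^sup>2 + N\<^sup>2)"
proof -
  define h where "h = sqrt \<eta>"
  define k where "k = sqrt \<kappa>"
  have hk: "h\<^sup>2 = \<eta>" "k\<^sup>2 = \<kappa>" "0 < h" "0 < k"
    using pos by (auto simp: h_def k_def)
  have "(2 * h * k)\<^sup>2 \<le> c\<^sup>2"
    using c hk by (simp add: power_mult_distrib)
  then have "2 * h * k \<le> c"
    using pos by (simp add: power2_le_iff_abs_le)
  have "2 * \<eta> * \<bar>S\<bar> \<le> 2 * \<eta> * (k * \<bar>X * N\<bar>)"
    using S pos hk by (intro mult_left_mono) (auto intro: order_trans mult_left_mono simp: k_def)
  also have "\<dots> = (2 * h * k) * (h * \<bar>X\<bar> * \<bar>N\<bar>)"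
    by (simp add: hk(1)[symmetric] power2_eq_square abs_mult mult_ac)
  also have "\<dots> \<le> c * (h * \<bar>X\<bar> * \<bar>N\<bar>)"
    using \<open>2 * h * k \<le> c\<close> hk by (intro mult_right_mono) auto
  also have "\<dots> \<le> c * ((\<eta> * X\<^sup>2 + N\<^sup>2) / 2)"
  proof -
    have "0 \<le> (h * \<bar>X\<bar> - \<bar>N\<bar>)\<^sup>2" by simp
    then have "h * \<bar>X\<bar> * \<bar>N\<bar> \<le> (\<eta> * X\<^sup>2 + N\<^sup>2) / 2"
      by (simp add: power2_diff power_mult_distrib hk)
    then show ?thesis
      using pos by (intro mult_left_mono) auto
  qed
  finally have "\<bar>2 * \<eta> * S\<bar> \<le> c / 2 * (\<eta> * X\<^sup>2 + N\<^sup>2)"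
    using pos by (simp add: abs_mult)
  then show "c / 2 * (\<eta> * X\<^sup>2 + N\<^sup>2) \<le> \<eta> * c * X\<^sup>2 + 2 * \<eta> * S + c * N\<^sup>2"
    and "\<eta> * c * X\<^sup>2 + 2 * \<eta> * S + c * N\<^sup>2 \<le> 3 * c / 2 * (\<eta> * X\<^sup>2 + N\<^sup>2)"
    by (auto simp: abs_le_iff algebra_simps)
qed


section \<open>Exponential decay along solutions\<close>

text \<open>
  Coordinates as inner products, so that differentiability of a curve passes to its coordinates.
\<close>

lemma inner_unit_vec: "inner (unit_vec j) l = coord l j"
proof -
  have "inner (unit_vec j) l = (\<Sum>i\<in>{j}. coord (unit_vec j) i * coord l i)"
    by (rule inner_fseq_superset) (auto simp: unit_vec.rep_eq split: if_splits)
  then show ?thesis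
    by (simp add: unit_vec.rep_eq)
qed

lemma coord_dual_field:
  assumes "j < m"
  shows "coord (dual_field m a b \<rho> \<eta> x l) j =
    \<eta> / \<rho> * (max (\<rho> * (inner (a j) x - coord b j) + coord l j) 0 - coord l j)"
  using assms by (simp add: dual_field_def unit_vec.rep_eq if_distrib cong: if_cong)

text \<open>
  The equilibrium equations are subtracted from the dynamics to obtain the linear form of
  \<open>lyapunov_dissipation\<close>. That \<open>\<mu> \<le> ell\<close> and \<open>\<kappa>1 \<le> \<kappa>2\<close> follows from the hypotheses since both spaces
  contain nonzero vectors, by \<open>n \<ge> 1\<close> and \<open>m \<ge> 1\<close>. The weight \<open>c\<close> cancels in the result, which is
  why the constants of the final estimate involve no parameter but \<open>\<eta>\<close>.
\<close>

lemma solution_exponential_bound: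
  assumes n: "1 \<le> n" and m: "1 \<le> m"
    and f: "has_gradient_field n f g"
    and pos: "0 < \<mu>" "0 < ell" "0 < \<kappa>1" "0 < \<kappa>2" "0 < \<eta>" "0 < \<rho>"
    and curvature: "\<And>y z. y \<in> Rn n \<Longrightarrow> z \<in> Rn n \<Longrightarrow>
         \<mu> * (norm (y - z))\<^sup>2 \<le> inner (g y - g z) (y - z) \<and>
         inner (g y - g z) (y - z) \<le> ell * (norm (y - z))\<^sup>2"
    and gram: "loewner_le m (scaled_id \<kappa>1) (row_gram a)" "loewner_le m (row_gram a) (scaled_id \<kappa>2)"
    and eq: "is_equilibrium n m g a b \<rho> \<eta> xs lams"
    and sol: "is_solution n m g a b \<rho> \<eta> x lam"
    and t: "0 \<le> t"
  shows "\<eta> * (norm (x t - xs))\<^sup>2 + (norm (lam t - lams))\<^sup>2 \<le>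
    3 * (\<eta> * (norm (x 0 - xs))\<^sup>2 + (norm (lam 0 - lams))\<^sup>2) * exp (- tau_ineq \<eta> \<rho> \<kappa>1 \<kappa>2 \<mu> ell * t)"
proof -
  note gram_ge = gram_lower_bound[OF gram(1)] and gram_le = gram_upper_bound[OF gram(2)]
  have \<kappa>: "\<kappa>1 \<le> \<kappa>2"
    using order_trans[OF gram_ge gram_le, of "\<lambda>_. 1"] m by simp
  have \<mu>: "\<mu> \<le> ell"
  proof -
    have e: "unit_vec 0 \<in> Rn n" "0 \<in> Rn n"
      using n subspace_0[OF subspace_Rn] by (auto simp: Rn_def unit_vec.rep_eq)
    have "(norm (unit_vec 0))\<^sup>2 = 1"
      by (simp add: power2_norm_eq_inner inner_unit_vec unit_vec.rep_eq)
    then show ?thesis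
      using curvature[OF e] by simp
  qed
  define c where
    "c = 20 * ell * (max (\<rho> * \<kappa>2 / \<mu>) (ell / \<mu>))\<^sup>2 * (max (\<eta> / (ell * \<rho>)) (ell / \<mu>))\<^sup>2 * \<kappa>2 / \<kappa>1"
  note weight = lyapunov_weight_bounds[OF pos(1) \<mu> pos(3) \<kappa> pos(5,6) c_def]
  have c: "0 < c"
    using weight(1) pos by simp

  define V where "V s = \<eta> * c * (norm (x s - xs))\<^sup>2
      + 2 * \<eta> * (\<Sum>j<m. inner (a j) (x s - xs) * coord (lam s - lams) j)
      + c * (\<Sum>j<m. (coord (lam s - lams) j)\<^sup>2)" for s
  define x' where "x' s = primal_field m g a b \<rho> (x s) (lam s)" for s
  define l' where "l' s = dual_field m a b \<rho> \<eta> (x s) (lam s)" for s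
  define V' where "V' s = 2 * \<eta> * c * inner (x s - xs) (x' s)
      + 2 * \<eta> * (\<Sum>j<m. inner (a j) (x' s) * coord (lam s - lams) j
          + inner (a j) (x s - xs) * coord (l' s) j)
      + 2 * c * (\<Sum>j<m. coord (lam s - lams) j * coord (l' s) j)" for s

  have xs: "xs \<in> Rn n" and lams: "lams \<in> Rn m"
    and eq_x: "primal_field m g a b \<rho> xs lams = 0" and eq_l: "dual_field m a b \<rho> \<eta> xs lams = 0"
    using eq by (auto simp: is_equilibrium_def)

  have deriv: "(V has_real_derivative V' s) (at s within {0..})" if s: "0 \<le> s" for s
  proof -
    have "(x has_vector_derivative x' s) (at s within {0..})"
      and "(lam has_vector_derivative l' s) (at s within {0..})"
      using sol s by (auto simp: is_solution_def x'_def l'_def)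
    from this[THEN has_vector_derivative_diff, OF has_vector_derivative_const]
    have dx: "((\<lambda>s. x s - xs) has_vector_derivative x' s) (at s within {0..})"
      and dl: "((\<lambda>s. lam s - lams) has_vector_derivative l' s) (at s within {0..})"
      by (simp_all only: diff_zero)
    have d_inner: "((\<lambda>s. inner v (x s - xs)) has_real_derivative inner v (x' s))
        (at s within {0..})" for v
      using bounded_linear.has_vector_derivative[OF bounded_linear_inner_right dx]
      by (simp only: has_real_derivative_iff_has_vector_derivative)
    have d_coord: "((\<lambda>s. coord (lam s - lams) j) has_real_derivative coord (l' s) j)
        (at s within {0..})" for j
      using bounded_linear.has_vector_derivative[OF bounded_linear_inner_right dl, of "unit_vec j"]
      by (simp only: has_real_derivative_iff_has_vector_derivative inner_unit_vec)
    have d_square: "((\<lambda>s. (coord (lam s - lams) j)\<^sup>2) has_real_derivative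
        2 * (coord (lam s - lams) j * coord (l' s) j)) (at s within {0..})" for j
      using DERIV_mult[OF d_coord d_coord, of j j]
      by (simp add: power2_eq_square mult.commute del: coord_simps)
    have d_norm: "((\<lambda>s. (norm (x s - xs))\<^sup>2) has_real_derivative 2 * inner (x s - xs) (x' s))
        (at s within {0..})"
      using bounded_bilinear.has_vector_derivative[OF bounded_bilinear_inner dx dx]
      by (simp only: power2_norm_eq_inner has_real_derivative_iff_has_vector_derivative
          inner_commute[of "x' s"] mult_2)
    have "(V has_real_derivative \<eta> * c * (2 * inner (x s - xs) (x' s))
        + 2 * \<eta> * (\<Sum>j<m. inner (a j) (x' s) * coord (lam s - lams) j
            + coord (l' s) j * inner (a j) (x s - xs))
        + c * (\<Sum>j<m. 2 * (coord (lam s - lams) j * coord (l' s) j))) (at s within {0..})"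
      unfolding V_def
      by (intro DERIV_add DERIV_cmult DERIV_sum DERIV_mult d_inner d_coord d_square d_norm)
    then show ?thesis
      by (simp only: V'_def sum_distrib_left[symmetric] mult_ac)
  qed

  have dissipation: "V' s \<le> - tau_ineq \<eta> \<rho> \<kappa>1 \<kappa>2 \<mu> ell * V s" if s: "0 \<le> s" for s
  proof -
    have xR: "x s \<in> Rn n"
      using sol s by (simp add: is_solution_def)
    define q where "q y l j = \<rho> * (inner (a j) y - coord b j) + coord l j" for y l j
    define w where "w j = max (q (x s) (lam s) j) 0 - max (q xs lams j) 0" for j
    have "\<exists>r. 0 \<le> r \<and> r \<le> 1 \<and> w j = r * (q (x s) (lam s) j - q xs lams j)" for j
      unfolding w_def by (rule max_zero_diff_factor) blast
    then obtain \<gamma> where \<gamma>: "0 \<le> \<gamma> j" "\<gamma> j \<le> 1" "w j = \<gamma> j * (q (x s) (lam s) j - q xs lams j)" for j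
      by metis
    have w_eq: "w j = \<gamma> j * (\<rho> * inner (a j) (x s - xs) + coord (lam s - lams) j)" for j
      unfolding \<gamma>(3) q_def by (simp add: inner_diff_right algebra_simps)
    have x'_eq: "x' s = - (g (x s) - g xs) - (\<Sum>j<m. w j *\<^sub>R a j)"
    proof -
      have "x' s = primal_field m g a b \<rho> (x s) (lam s) - primal_field m g a b \<rho> xs lams"
        by (simp add: x'_def eq_x)
      then show ?thesis
        by (simp add: primal_field_def w_def q_def scaleR_diff_left sum_subtractf)
    qed
    have l'_eq: "coord (l' s) j = \<eta> / \<rho> * (w j - coord (lam s - lams) j)" if "j < m" for j
    proof -
      have "coord (l' s) j = coord (dual_field m a b \<rho> \<eta> (x s) (lam s)) j
          - coord (dual_field m a b \<rho> \<eta> xs lams) j"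
        by (simp add: l'_def eq_l)
      then show ?thesis
        unfolding coord_dual_field[OF that] w_def q_def by (simp add: algebra_simps)
    qed
    have monotone: "0 \<le> inner (g y - g z) (y - z)" if "y \<in> Rn n" "z \<in> Rn n" for y z
      using curvature[OF that] pos by (meson less_imp_le mult_nonneg_nonneg order_trans zero_le_power2)
    have "(norm (g (x s) - g xs))\<^sup>2 \<le> ell * inner (g (x s) - g xs) (x s - xs)"
      using gradient_cocoercive[OF f pos(2) xR xs monotone] curvature by blast
    from lyapunov_dissipation[OF gram_le gram_ge \<gamma>(1,2) w_eq x'_eq _ this pos(1) \<mu> pos(3) \<kappa>
        pos(5,6) c weight(1-4)]
    show ?thesis
      using curvature[OF xR xs] by (simp add: V_def V'_def l'_eq weight(5) del: coord_simps)
  qed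

  have sum_le: "c / 2 * (\<eta> * (norm (x s - xs))\<^sup>2 + (norm (lam s - lams))\<^sup>2) \<le> V s"
    and le_sum: "V s \<le> 3 * c / 2 * (\<eta> * (norm (x s - xs))\<^sup>2 + (norm (lam s - lams))\<^sup>2)"
    if s: "0 \<le> s" for s
  proof -
    define v where "v = coord (lam s - lams)"
    define S where "S = (\<Sum>j<m. inner (a j) (x s - xs) * v j)"
    have "lam s - lams \<in> Rn m"
      using sol s subspace_diff[OF subspace_Rn _ lams] by (simp add: is_solution_def)
    then have N: "(\<Sum>j<m. (v j)\<^sup>2) = (norm (lam s - lams))\<^sup>2"
      unfolding v_def by (simp add: norm_Rn sum_nonneg del: coord_simps)
    have "norm (\<Sum>j<m. v j *\<^sub>R a j) \<le> sqrt (\<kappa>2 * (norm (lam s - lams))\<^sup>2)"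
      using gram_le[of v] N by (simp add: real_le_rsqrt)
    then have "norm (\<Sum>j<m. v j *\<^sub>R a j) \<le> sqrt \<kappa>2 * norm (lam s - lams)"
      by (simp add: real_sqrt_mult)
    moreover have "S = inner (\<Sum>j<m. v j *\<^sub>R a j) (x s - xs)"
      by (simp add: S_def inner_sum_left mult.commute)
    ultimately have S: "\<bar>S\<bar> \<le> sqrt \<kappa>2 * (norm (x s - xs) * norm (lam s - lams))"
      using Cauchy_Schwarz_ineq2[of "\<Sum>j<m. v j *\<^sub>R a j" "x s - xs"]
        mult_right_mono[OF _ norm_ge_zero, of _ _ "x s - xs"]
      by (fastforce simp: mult_ac)
    have "20 * ell * (20 * \<kappa>2 * \<eta>) \<le> c * (c * \<mu>)"
      using pos c by (intro mult_mono[OF weight(1,4)]) auto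
    also have "\<dots> \<le> c * (c * ell)"
      using c \<mu> by (intro mult_left_mono) auto
    finally have "400 * (\<kappa>2 * \<eta>) \<le> c\<^sup>2"
      using pos by (simp add: power2_eq_square mult_ac)
    moreover have "0 \<le> \<kappa>2 * \<eta>" using pos by simp
    ultimately have "4 * \<eta> * \<kappa>2 \<le> c\<^sup>2" by (simp add: mult_ac)
    from cross_term_absorbed[OF S pos(5,4) c this]
    show "c / 2 * (\<eta> * (norm (x s - xs))\<^sup>2 + (norm (lam s - lams))\<^sup>2) \<le> V s"
      and "V s \<le> 3 * c / 2 * (\<eta> * (norm (x s - xs))\<^sup>2 + (norm (lam s - lams))\<^sup>2)"
      unfolding V_def S_def N[symmetric] v_def by auto
  qed

  have "c / 2 * (\<eta> * (norm (x t - xs))\<^sup>2 + (norm (lam t - lams))\<^sup>2)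
      \<le> V 0 * exp (- tau_ineq \<eta> \<rho> \<kappa>1 \<kappa>2 \<mu> ell * t)"
    by (rule order_trans[OF sum_le[OF t] exponential_decay[OF deriv dissipation t]])
  also have "\<dots> \<le> 3 * c / 2 * (\<eta> * (norm (x 0 - xs))\<^sup>2 + (norm (lam 0 - lams))\<^sup>2)
      * exp (- tau_ineq \<eta> \<rho> \<kappa>1 \<kappa>2 \<mu> ell * t)"
    by (intro mult_right_mono le_sum) auto
  also have "\<dots> = c / 2 * (3 * (\<eta> * (norm (x 0 - xs))\<^sup>2 + (norm (lam 0 - lams))\<^sup>2)
      * exp (- tau_ineq \<eta> \<rho> \<kappa>1 \<kappa>2 \<mu> ell * t))"
    by simp
  finally show ?thesis
    using c by (simp only: mult_le_cancel_left_pos half_gt_zero)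
qed

lemma le_sqrt_mult_exp:
  fixes r K :: real
  assumes "r\<^sup>2 \<le> K * exp (- \<tau> * t)" and "0 \<le> K"
  shows "r \<le> (sqrt K + 1) * exp (- (1 / 2) * \<tau> * t)"
proof -
  define e where "e = exp (- (1 / 2) * \<tau> * t)"
  have "e * e = exp (- \<tau> * t)"
    unfolding e_def mult_exp_exp by (rule arg_cong[of _ _ exp]) simp
  then have "r\<^sup>2 \<le> (sqrt K * e)\<^sup>2"
    using assms by (simp only: power_mult_distrib real_sqrt_pow2) (simp only: power2_eq_square)
  moreover have e: "0 < e"
    by (simp only: e_def exp_gt_zero)
  ultimately have "r \<le> sqrt K * e"
    using power2_le_imp_le[of r "sqrt K * e"] assms by simp
  with e show ?thesis
    unfolding e_def[symmetric] by (simp add: distrib_right)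
qed

text \<open>
  The common bound on \<open>\<eta> \<parallel>x\<parallel>\<^sup>2 + \<parallel>v\<parallel>\<^sup>2\<close> is read off for each variable separately; taking square roots
  halves the rate. The summand \<open>1\<close> in the constants keeps them positive when the solution starts at
  the equilibrium.
\<close>

theorem theorem2:
  shows "\<exists>C3 C4 :: real \<Rightarrow> real \<Rightarrow> real \<Rightarrow> real \<Rightarrow> real \<Rightarrow> real \<Rightarrow> real \<Rightarrow> real \<Rightarrow> real.
    \<forall>(n::nat) (m::nat) (f :: fseq \<Rightarrow> real) (g :: fseq \<Rightarrow> fseq) (a :: nat \<Rightarrow> fseq) (b :: fseq)
      (\<mu>::real) (ell::real) (\<kappa>1::real) (\<kappa>2::real) (\<eta>::real) (\<rho>::real)
      (xs :: fseq) (lams :: fseq) (x :: real \<Rightarrow> fseq) (lam :: real \<Rightarrow> fseq).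
      n \<ge> 1 \<longrightarrow> m \<ge> 1 \<longrightarrow>
      (\<forall>j<m. a j \<in> Rn n) \<longrightarrow> b \<in> Rn m \<longrightarrow>
      has_gradient_field n f g \<longrightarrow> g differentiable_on Rn n \<longrightarrow>
      \<mu> > 0 \<longrightarrow> ell > 0 \<longrightarrow>
      (\<forall>y\<in>Rn n. \<forall>z\<in>Rn n.
         \<mu> * (norm (y - z))\<^sup>2 \<le> inner (g y - g z) (y - z) \<and>
         inner (g y - g z) (y - z) \<le> ell * (norm (y - z))\<^sup>2) \<longrightarrow>
      full_row_rank m a \<longrightarrow>
      \<kappa>1 > 0 \<longrightarrow> \<kappa>2 > 0 \<longrightarrow>
      loewner_le m (scaled_id \<kappa>1) (row_gram a) \<longrightarrow>
      loewner_le m (row_gram a) (scaled_id \<kappa>2) \<longrightarrow>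
      \<eta> > 0 \<longrightarrow> \<rho> > 0 \<longrightarrow>
      is_equilibrium n m g a b \<rho> \<eta> xs lams \<longrightarrow>
      is_solution n m g a b \<rho> \<eta> x lam \<longrightarrow>
      C3 \<eta> \<rho> \<kappa>1 \<kappa>2 \<mu> ell (norm (x 0 - xs)) (norm (lam 0 - lams)) > 0 \<and>
      C4 \<eta> \<rho> \<kappa>1 \<kappa>2 \<mu> ell (norm (x 0 - xs)) (norm (lam 0 - lams)) > 0 \<and>
      (\<forall>t\<ge>0.
         norm (x t - xs) \<le> C3 \<eta> \<rho> \<kappa>1 \<kappa>2 \<mu> ell (norm (x 0 - xs)) (norm (lam 0 - lams))
                             * exp (- (1 / 2) * tau_ineq \<eta> \<rho> \<kappa>1 \<kappa>2 \<mu> ell * t) \<and>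
         norm (lam t - lams) \<le> C4 \<eta> \<rho> \<kappa>1 \<kappa>2 \<mu> ell (norm (x 0 - xs)) (norm (lam 0 - lams))
                             * exp (- (1 / 2) * tau_ineq \<eta> \<rho> \<kappa>1 \<kappa>2 \<mu> ell * t))"
proof -
  define C3 C4 :: "real \<Rightarrow> real \<Rightarrow> real \<Rightarrow> real \<Rightarrow> real \<Rightarrow> real \<Rightarrow> real \<Rightarrow> real \<Rightarrow> real" where
    "C3 \<eta> \<rho> \<kappa>1 \<kappa>2 \<mu> ell X Y = sqrt (3 * (X\<^sup>2 + Y\<^sup>2 / \<eta>)) + 1" and
    "C4 \<eta> \<rho> \<kappa>1 \<kappa>2 \<mu> ell X Y = sqrt (3 * (\<eta> * X\<^sup>2 + Y\<^sup>2)) + 1"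
    for \<eta> \<rho> \<kappa>1 \<kappa>2 \<mu> ell X Y
  show ?thesis
  proof (rule exI[of _ C3], rule exI[of _ C4], intro allI impI)
    fix n m :: nat and f :: "fseq \<Rightarrow> real" and g :: "fseq \<Rightarrow> fseq" and a :: "nat \<Rightarrow> fseq" and b :: fseq
      and \<mu> ell \<kappa>1 \<kappa>2 \<eta> \<rho> :: real and xs lams :: fseq and x lam :: "real \<Rightarrow> fseq"
    let ?X = "norm (x 0 - xs)" and ?Y = "norm (lam 0 - lams)"
    let ?\<tau> = "tau_ineq \<eta> \<rho> \<kappa>1 \<kappa>2 \<mu> ell"
    assume nm: "n \<ge> 1" "m \<ge> 1"
      and "\<forall>j<m. a j \<in> Rn n" "b \<in> Rn m"
      and f: "has_gradient_field n f g" and "g differentiable_on Rn n"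
      and f_pos: "\<mu> > 0" "ell > 0"
      and curvature: "\<forall>y\<in>Rn n. \<forall>z\<in>Rn n.
          \<mu> * (norm (y - z))\<^sup>2 \<le> inner (g y - g z) (y - z) \<and>
          inner (g y - g z) (y - z) \<le> ell * (norm (y - z))\<^sup>2"
      and "full_row_rank m a"
      and \<kappa>_pos: "\<kappa>1 > 0" "\<kappa>2 > 0"
      and gram: "loewner_le m (scaled_id \<kappa>1) (row_gram a)"
        "loewner_le m (row_gram a) (scaled_id \<kappa>2)"
      and gain_pos: "\<eta> > 0" "\<rho> > 0"
      and dynamics: "is_equilibrium n m g a b \<rho> \<eta> xs lams" "is_solution n m g a b \<rho> \<eta> x lam"
    have \<eta>: "0 < \<eta>" by fact
    have bound: "\<eta> * (norm (x t - xs))\<^sup>2 + (norm (lam t - lams))\<^sup>2 \<le>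
        3 * (\<eta> * ?X\<^sup>2 + ?Y\<^sup>2) * exp (- ?\<tau> * t)" if "0 \<le> t" for t
      by (rule solution_exponential_bound[OF nm f f_pos \<kappa>_pos gain_pos _ gram dynamics that])
         (use curvature in blast)
    have x_bound: "norm (x t - xs) \<le> C3 \<eta> \<rho> \<kappa>1 \<kappa>2 \<mu> ell ?X ?Y * exp (- (1 / 2) * ?\<tau> * t)"
      and lam_bound: "norm (lam t - lams) \<le> C4 \<eta> \<rho> \<kappa>1 \<kappa>2 \<mu> ell ?X ?Y * exp (- (1 / 2) * ?\<tau> * t)"
      if t: "0 \<le> t" for t
    proof -
      have "\<eta> * (norm (x t - xs))\<^sup>2 \<le> 3 * (\<eta> * ?X\<^sup>2 + ?Y\<^sup>2) * exp (- ?\<tau> * t)"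
        by (rule order_trans[OF _ bound[OF t]]) simp
      also have "\<dots> = \<eta> * (3 * (?X\<^sup>2 + ?Y\<^sup>2 / \<eta>) * exp (- ?\<tau> * t))"
        using \<eta> by (simp add: field_simps)
      finally have "(norm (x t - xs))\<^sup>2 \<le> 3 * (?X\<^sup>2 + ?Y\<^sup>2 / \<eta>) * exp (- ?\<tau> * t)"
        using \<eta> by (simp only: mult_le_cancel_left_pos)
      then show "norm (x t - xs) \<le> C3 \<eta> \<rho> \<kappa>1 \<kappa>2 \<mu> ell ?X ?Y * exp (- (1 / 2) * ?\<tau> * t)"
        unfolding C3_def using \<eta> by (intro le_sqrt_mult_exp) auto
      have "(norm (lam t - lams))\<^sup>2 \<le> 3 * (\<eta> * ?X\<^sup>2 + ?Y\<^sup>2) * exp (- ?\<tau> * t)"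
        by (rule order_trans[OF _ bound[OF t]]) (use \<eta> in simp)
      then show "norm (lam t - lams) \<le> C4 \<eta> \<rho> \<kappa>1 \<kappa>2 \<mu> ell ?X ?Y * exp (- (1 / 2) * ?\<tau> * t)"
        unfolding C4_def using \<eta> by (intro le_sqrt_mult_exp) auto
    qed
    have C_pos: "0 < C3 \<eta> \<rho> \<kappa>1 \<kappa>2 \<mu> ell ?X ?Y" "0 < C4 \<eta> \<rho> \<kappa>1 \<kappa>2 \<mu> ell ?X ?Y"
      unfolding C3_def C4_def using \<eta> by (auto intro!: add_nonneg_pos)
    show "0 < C3 \<eta> \<rho> \<kappa>1 \<kappa>2 \<mu> ell ?X ?Y \<and> 0 < C4 \<eta> \<rho> \<kappa>1 \<kappa>2 \<mu> ell ?X ?Y \<and>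
        (\<forall>t\<ge>0. norm (x t - xs) \<le> C3 \<eta> \<rho> \<kappa>1 \<kappa>2 \<mu> ell ?X ?Y * exp (- (1 / 2) * ?\<tau> * t) \<and>
          norm (lam t - lams) \<le> C4 \<eta> \<rho> \<kappa>1 \<kappa>2 \<mu> ell ?X ?Y * exp (- (1 / 2) * ?\<tau> * t))"
      using C_pos x_bound lam_bound by simp
  qed
qed

end
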